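(* Let $\sigma$ be a finite positive measure on the unit disk $\mathbb{D}$ that is absolutely continuous with respect to the Lebesgue measure on $\mathbb{D}$ and has the reverse doubling property. Then $\sigma$ is a $\mathcal{D}$-Carleson measure; that is, there is a constant $C$ such that $\int_{\mathbb{D}}|f|^2\,d\sigma\le C\|f\|_{\mathcal{D}}^2$ for all $f\in\mathcal{D}$.
   Context: $\mathbb{D}$ is the open unit disk in $\mathbb{C}$, $\mathbb{T}$ the unit circle, $dA$ the Lebesgue area measure. The Dirichlet space $\mathcal{D}$ consists of the analytic functions $f$ on $\mathbb{D}$ with $\|f\|_{\mathcal{D}}^2=|f(0)|^2+\frac1\pi\int_{\mathbb{D}}|f'(z)|^2\,dA(z)<\infty$. For an interval (arc) $I\subset\mathbb{T}$ let $|I|$ denote its arc length normalized so that $|\mathbb{T}|=1$, and put $Q_I=\{z\in\mathbb{D}: 1-|I|\le |z|<1,\ z/|z|\in I\}$ and $B_I=\{z\in\mathbb{D}: 1-\tfrac{|I|}{2}<|z|<1,\ z/|z|\in I\}$. For a set $E\subset\mathbb{D}$, $|E|_\sigma$ denotes $\sigma(E)$. A measure $\sigma$ on $\mathbb{D}$ has the reverse doubling property (is a reverse doubling measure) if there is a constant $\delta<1$ such that $\frac{|B_I|_\sigma}{|Q_I|_\sigma}<\delta$ for every interval $I\subset\mathbb{T}$ (in particular these ratios are assumed to be meaningful, i.e. $0<|Q_I|_\sigma<\infty$). *)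

theory Defs
  imports "HOL-Analysis.Analysis"
begin

abbreviation unit_disk :: "complex set" where
  "unit_disk \<equiv> ball 0 1"

text \<open>Arcs may be open, closed, half-open, or the whole circle. Degenerate arcs (empty or a single
  point) are excluded: their boxes are empty, so the ratio in the reverse doubling condition would
  not be meaningful.\<close>

definition circle_arc :: "complex set \<Rightarrow> bool" where
  "circle_arc I \<longleftrightarrow> (\<exists>J::real set. is_interval J \<and> interior J \<noteq> {} \<and> I = cis ` J)"

text \<open>Arc length measure on the unit circle, normalized to total mass 1.\<close>

definition arc_len :: "complex set \<Rightarrow> real" where
  "arc_len I = measure lborel {t \<in> {0..<2*pi}. cis t \<in> I} / (2*pi)"

text \<open>In the two boxes the origin never satisfies the angular condition, since \<open>0 / 0 = 0\<close> is not
  on the unit circle. It could only matter for \<open>carleson_box I\<close> with \<open>arc_len I = 1\<close>, and is a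
  null set for absolutely continuous measures.\<close>

definition carleson_box :: "complex set \<Rightarrow> complex set" where
  "carleson_box I =
     {z \<in> unit_disk. 1 - arc_len I \<le> cmod z \<and> cmod z < 1 \<and> z / of_real (cmod z) \<in> I}"

definition boundary_half_box :: "complex set \<Rightarrow> complex set" where
  "boundary_half_box I =
     {z \<in> unit_disk. 1 - arc_len I / 2 < cmod z \<and> cmod z < 1 \<and> z / of_real (cmod z) \<in> I}"

definition reverse_doubling :: "complex measure \<Rightarrow> bool" where
  "reverse_doubling \<sigma> \<longleftrightarrow>
     (\<exists>\<delta><1. \<forall>I. circle_arc I \<longrightarrow>
        0 < emeasure \<sigma> (carleson_box I) \<and> emeasure \<sigma> (carleson_box I) < \<infinity> \<and>
        measure \<sigma> (boundary_half_box I) / measure \<sigma> (carleson_box I) < \<delta>)"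

definition dirichlet_space :: "(complex \<Rightarrow> complex) set" where
  "dirichlet_space =
     {f. f holomorphic_on unit_disk \<and>
         set_integrable lborel unit_disk (\<lambda>z. (cmod (deriv f z))\<^sup>2)}"

definition dirichlet_norm :: "(complex \<Rightarrow> complex) \<Rightarrow> real" where
  "dirichlet_norm f =
     sqrt ((cmod (f 0))\<^sup>2 + 1 / pi * (LINT z:unit_disk|lborel. (cmod (deriv f z))\<^sup>2))"

definition dirichlet_carleson :: "complex measure \<Rightarrow> bool" where
  "dirichlet_carleson \<sigma> \<longleftrightarrow>
     (\<exists>C\<ge>0. \<forall>f\<in>dirichlet_space.
        (\<integral>\<^sup>+z\<in>unit_disk. ennreal ((cmod (f z))\<^sup>2) \<partial>\<sigma>) \<le> ennreal (C * (dirichlet_norm f)\<^sup>2))"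

end

theory Submission
  imports Defs "HOL-Complex_Analysis.Complex_Analysis"
begin

text \<open>
  Comparing an arc with the concentric arc of a quarter of its length, reverse doubling gives
  \<open>\<sigma>(Q\<^sub>I) \<le> \<delta>\<^sup>n \<sigma>(\<D>)\<close> for \<open>|I| = 4\<^sup>-\<^sup>n\<close>, i.e. a power decay of order \<open>|I|\<close> to some \<open>\<epsilon> > 0\<close>.
  Writing \<open>f z - f 0\<close> as the integral of \<open>f'\<close> along a radius, the Cauchy--Schwarz inequality with the weight
  \<open>(1 - |w|)\<close> to the \<open>\<epsilon> - 1\<close>, and the sub-mean value property of \<open>|f'|\<^sup>2\<close> on discs
  of radius \<open>(1 - |w|)/2\<close>, bound \<open>|f z - f 0|\<^sup>2\<close> by the integral of \<open>|f'|\<^sup>2\<close> against a kernel.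
  By Tonelli it then suffices that the kernel, integrated in \<open>\<sigma>\<close>, is bounded: for a point at
  distance \<open>s\<close> from the circle the kernel lives on a Carleson box of size comparable to \<open>s\<close>,
  where the power decay compensates the weight exactly.
\<close>

section \<open>Rotation invariance of area measure\<close>

lemma borel_measurable_Complex [measurable]:
  assumes [measurable]: "f \<in> borel_measurable M" "g \<in> borel_measurable M"
  shows "(\<lambda>x. Complex (f x) (g x)) \<in> borel_measurable M"
  unfolding Complex_eq by measurable

text \<open>Lebesgue measure is determined by its values on boxes, and a complex box is the product
  of two real intervals. This opens the way to Tonelli in the real and imaginary
  coordinates.\<close>

lemma lborel_complex_eq:
  "(lborel :: complex measure) = distr (lborel \<Otimes>\<^sub>M lborel) borel (\<lambda>(x, y). Complex x y)"
proof (rule lborel_eqI)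
  fix l u :: complex
  assume le: "\<And>b. b \<in> Basis \<Longrightarrow> l \<bullet> b \<le> u \<bullet> b"
  have le': "Re l \<le> Re u" "Im l \<le> Im u"
    using le[of 1] le[of \<i>] by (auto simp: Basis_complex_def)
  have "(\<lambda>(x, y). Complex x y) -` box l u \<inter> space (lborel \<Otimes>\<^sub>M lborel)
      = {Re l<..<Re u} \<times> {Im l<..<Im u}"
    by (auto simp: box_def Basis_complex_def space_pair_measure)
  then show "emeasure (distr (lborel \<Otimes>\<^sub>M lborel) borel (\<lambda>(x, y). Complex x y)) (box l u)
      = ennreal (\<Prod>b\<in>Basis. (u - l) \<bullet> b)"
    using le' by (simp add: emeasure_distr lborel.emeasure_pair_measure_Times Basis_complex_def ennreal_mult)
qed simp

lemma nn_integral_lborel_complex: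
  fixes h :: "complex \<Rightarrow> ennreal"
  assumes [measurable]: "h \<in> borel_measurable borel"
  shows "(\<integral>\<^sup>+z. h z \<partial>lborel) = (\<integral>\<^sup>+x. \<integral>\<^sup>+y. h (Complex x y) \<partial>lborel \<partial>lborel)"
    and "(\<integral>\<^sup>+z. h z \<partial>lborel) = (\<integral>\<^sup>+y. \<integral>\<^sup>+x. h (Complex x y) \<partial>lborel \<partial>lborel)"
proof -
  have "(\<integral>\<^sup>+z. h z \<partial>lborel) = (\<integral>\<^sup>+(x, y). h (Complex x y) \<partial>(lborel \<Otimes>\<^sub>M lborel))"
    by (subst lborel_complex_eq) (simp add: nn_integral_distr case_prod_unfold)
  then show "(\<integral>\<^sup>+z. h z \<partial>lborel) = (\<integral>\<^sup>+x. \<integral>\<^sup>+y. h (Complex x y) \<partial>lborel \<partial>lborel)"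
    and "(\<integral>\<^sup>+z. h z \<partial>lborel) = (\<integral>\<^sup>+y. \<integral>\<^sup>+x. h (Complex x y) \<partial>lborel \<partial>lborel)"
    by (simp_all add: lborel.nn_integral_fst[symmetric] lborel_pair.Fubini'[of "\<lambda>x y. h (Complex x y)"])
qed

text \<open>A shear moves each horizontal (or vertical) line by a constant. With that coordinate as
  the inner variable, translation invariance on the real line suffices.\<close>

lemma nn_integral_shear:
  fixes h :: "complex \<Rightarrow> ennreal"
  assumes [measurable]: "h \<in> borel_measurable borel"
  shows nn_integral_shear_Re: "(\<integral>\<^sup>+z. h (Complex (Re z + a * Im z) (Im z)) \<partial>lborel) = (\<integral>\<^sup>+z. h z \<partial>lborel)"
    and nn_integral_shear_Im: "(\<integral>\<^sup>+z. h (Complex (Re z) (Im z + a * Re z)) \<partial>lborel) = (\<integral>\<^sup>+z. h z \<partial>lborel)"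
proof -
  have C: "(\<lambda>x. h (Complex x y)) \<in> borel_measurable borel"
     "(\<lambda>x. h (Complex y x)) \<in> borel_measurable borel" for y
    by measurable
  show "(\<integral>\<^sup>+z. h (Complex (Re z + a * Im z) (Im z)) \<partial>lborel) = (\<integral>\<^sup>+z. h z \<partial>lborel)"
    using nn_integral_real_affine[OF C(1), where c = 1]
    by (simp add: nn_integral_lborel_complex(2) add.commute[of _ "a * _"])
  show "(\<integral>\<^sup>+z. h (Complex (Re z) (Im z + a * Re z)) \<partial>lborel) = (\<integral>\<^sup>+z. h z \<partial>lborel)"
    using nn_integral_real_affine[OF C(2), where c = 1]
    by (simp add: nn_integral_lborel_complex(1) add.commute[of _ "a * _"])
qed

text \<open>A rotation by an angle other than \<open>\<pi>\<close> is a product of three shears.\<close>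

lemma nn_integral_rotate_small:
  fixes h :: "complex \<Rightarrow> ennreal"
  assumes h [measurable]: "h \<in> borel_measurable borel" and c: "cos (\<theta> / 2) \<noteq> 0"
  shows "(\<integral>\<^sup>+z. h (cis \<theta> * z) \<partial>lborel) = (\<integral>\<^sup>+z. h z \<partial>lborel)"
proof -
  define A where "A = (\<lambda>z. Complex (Re z + (- tan (\<theta>/2)) * Im z) (Im z))"
  define B where "B = (\<lambda>z. Complex (Re z) (Im z + sin \<theta> * Re z))"
  have [measurable]: "A \<in> borel_measurable borel" "B \<in> borel_measurable borel"
    unfolding A_def B_def by measurable
  have s: "sin \<theta> = 2 * sin (\<theta>/2) * cos (\<theta>/2)" "cos \<theta> = 1 - 2 * (sin (\<theta>/2))\<^sup>2"
    "(cos (\<theta>/2))\<^sup>2 = 1 - (sin (\<theta>/2))\<^sup>2"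
    using sin_double[of "\<theta>/2"] cos_double_sin[of "\<theta>/2"] by (auto simp: cos_squared_eq)
  \<comment> \<open>This identity and the next are exactly what the entries of the matrix product of
    \<open>A\<close>, \<open>B\<close>, \<open>A\<close> require in order to be those of the
    rotation matrix.\<close>
  have "tan (\<theta>/2) * sin \<theta> = 1 - cos \<theta>"
    using c unfolding s by (simp add: tan_def power2_eq_square)
  moreover have "tan (\<theta>/2) * (1 + cos \<theta>) = sin \<theta>"
  proof -
    have "1 + cos \<theta> = 2 * (cos (\<theta>/2))\<^sup>2" unfolding s(2,3) by simp
    then show ?thesis using c by (simp add: s(1) tan_def power2_eq_square)
  qed
  ultimately have "A (B (A z)) = cis \<theta> * z" for z
    unfolding A_def B_def complex_eq_iff by (simp, algebra)
  then have "(\<integral>\<^sup>+z. h (cis \<theta> * z) \<partial>lborel) = (\<integral>\<^sup>+z. h (A (B (A z))) \<partial>lborel)" by simp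
  also have "\<dots> = (\<integral>\<^sup>+z. h (A (B z)) \<partial>lborel)"
    unfolding A_def by (rule nn_integral_shear_Re) measurable
  also have "\<dots> = (\<integral>\<^sup>+z. h (A z) \<partial>lborel)"
    unfolding B_def by (rule nn_integral_shear_Im) measurable
  also have "\<dots> = (\<integral>\<^sup>+z. h z \<partial>lborel)"
    unfolding A_def by (rule nn_integral_shear_Re) measurable
  finally show ?thesis .
qed

lemma nn_integral_rotate:
  fixes h :: "complex \<Rightarrow> ennreal"
  assumes h [measurable]: "h \<in> borel_measurable borel"
  shows "(\<integral>\<^sup>+z. h (cis \<theta> * z) \<partial>lborel) = (\<integral>\<^sup>+z. h z \<partial>lborel)"
proof (cases "cos (\<theta> / 2) = 0")
  case True
  \<comment> \<open>The shear factor \<open>tan (\<theta>/2)\<close> breaks down here, so the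
    rotation is done as two rotations by half the angle. Their shears exist:
    \<open>cos (\<theta>/4) = 0\<close> would force \<open>cos (\<theta>/2) = -1\<close>.\<close>
  have "cos (\<theta> / 2 / 2) \<noteq> 0"
    using True cos_double_cos[of "\<theta>/2/2"] by auto
  note half = nn_integral_rotate_small[OF _ this]
  have "(\<integral>\<^sup>+z. h (cis \<theta> * z) \<partial>lborel) = (\<integral>\<^sup>+z. h (cis (\<theta>/2) * (cis (\<theta>/2) * z)) \<partial>lborel)"
    by (simp add: mult.assoc[symmetric] cis_mult)
  also have "\<dots> = (\<integral>\<^sup>+z. h z \<partial>lborel)"
    by (subst half[of "\<lambda>z. h (cis (\<theta>/2) * z)"], measurable) (rule half[OF h])
  finally show ?thesis .
qed (rule nn_integral_rotate_small[OF h])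

section \<open>Mean value inequalities\<close>

text \<open>Cauchy's formula is applied to the square of \<open>g\<close>, which is again
  holomorphic. Moving the norm inside the integral then gives the bound directly.\<close>

lemma holomorphic_mean_square_le:
  assumes g: "g holomorphic_on cball 0 1"
  shows "ennreal ((cmod (g 0))\<^sup>2) \<le>
    (\<integral>\<^sup>+t. ennreal ((cmod (g (cis (2 * pi * t))))\<^sup>2) * indicator {0..1} t \<partial>lborel)"
proof -
  define q where "q = (\<lambda>t. (g (cis (2 * pi * t)))\<^sup>2)"
  have "(\<lambda>z. (g z)\<^sup>2) holomorphic_on cball 0 1"
    using g by (intro holomorphic_intros)
  then have "((\<lambda>u. (g u)\<^sup>2 / (u - 0)) has_contour_integral (2 * of_real pi * \<i> * (g 0)\<^sup>2)) (circlepath 0 1)"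
    by (rule Cauchy_integral_circlepath_simple) simp
  then have "((\<lambda>t. 2 * of_real pi * \<i> * q t) has_integral (2 * of_real pi * \<i> * (g 0)\<^sup>2)) {0..1}"
    unfolding has_contour_integral_def
  proof (rule has_integral_eq[rotated])
    fix t :: real
    assume "t \<in> {0..1}"
    then have vd: "vector_derivative (circlepath 0 1) (at t within {0..1})
        = 2 * of_real pi * \<i> * exp (2 * of_real pi * \<i> * of_real t)"
      by (simp add: vector_derivative_circlepath01)
    show "(g (circlepath 0 1 t))\<^sup>2 / (circlepath 0 1 t - 0)
        * vector_derivative (circlepath 0 1) (at t within {0..1}) = 2 * of_real pi * \<i> * q t"
      unfolding vd by (simp add: circlepath q_def cis_conv_exp mult_ac)
  qed
  then have q: "(q has_integral (g 0)\<^sup>2) {0..1}"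
    by (drule_tac c = "1 / (2 * of_real pi * \<i>)" in has_integral_mult_right) simp
  have c: "continuous_on {0..1} q"
    unfolding q_def
    by (intro continuous_intros continuous_on_compose2[OF holomorphic_on_imp_continuous_on[OF g]]) auto
  then have "((\<lambda>t. cmod (q t)) has_integral integral {0..1} (\<lambda>t. cmod (q t))) {0..1}"
    by (intro integrable_integral integrable_continuous_interval continuous_intros)
  then have "(\<integral>\<^sup>+t. ennreal (cmod (q t)) * indicator {0..1} t \<partial>lborel) = ennreal (integral {0..1} (\<lambda>t. cmod (q t)))"
    by (intro nn_integral_has_integral_lebesgue') auto
  moreover have "cmod ((g 0)\<^sup>2) \<le> integral {0..1} (\<lambda>t. cmod (q t))"
    unfolding integral_unique[OF q, symmetric]
    by (intro integral_norm_bound_integral integrable_continuous_interval c continuous_intros) auto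
  ultimately show ?thesis
    by (simp add: q_def norm_power ennreal_leI)
qed

lemma borel_measurable_norm_square_indicator:
  fixes g :: "complex \<Rightarrow> complex"
  assumes "open S" "continuous_on S g"
  shows "(\<lambda>u. ennreal ((cmod (g u))\<^sup>2) * indicator S u) \<in> borel_measurable borel"
proof -
  have "(\<lambda>u. indicator S u *\<^sub>R (cmod (g u))\<^sup>2) \<in> borel_measurable borel"
    using assms by (intro borel_measurable_continuous_on_indicator continuous_intros) auto
  then have "(\<lambda>u. ennreal (indicator S u *\<^sub>R (cmod (g u))\<^sup>2)) \<in> borel_measurable borel"
    by measurable
  also have "(\<lambda>u. ennreal (indicator S u *\<^sub>R (cmod (g u))\<^sup>2)) = (\<lambda>u. ennreal ((cmod (g u))\<^sup>2) * indicator S u)"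
    by (auto simp: indicator_def)
  finally show ?thesis .
qed

text \<open>Rotation invariance replaces polar coordinates: every point of the disc is averaged over
  its circle about the centre, the circle mean inequality applies there, and after Tonelli each
  rotated integral equals the unrotated one.\<close>

lemma holomorphic_area_mean_square_le:
  assumes g: "g holomorphic_on ball w r" and "0 \<le> r"
  shows "ennreal ((cmod (g w))\<^sup>2) * ennreal (pi * r\<^sup>2) \<le>
    (\<integral>\<^sup>+u. ennreal ((cmod (g u))\<^sup>2) * indicator (ball w r) u \<partial>lborel)"
proof -
  define G where "G = (\<lambda>u. ennreal ((cmod (g u))\<^sup>2) * indicator (ball w r) u)"
  have G [measurable]: "G \<in> borel_measurable borel"
    unfolding G_def
    by (intro borel_measurable_norm_square_indicator holomorphic_on_imp_continuous_on g open_ball)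
  define H where "H = (\<lambda>u. G (w + u))"
  have H [measurable]: "H \<in> borel_measurable borel"
    unfolding H_def by measurable
  have cis [measurable]: "(\<lambda>t. cis (2 * pi * t)) \<in> borel_measurable borel"
    by (intro borel_measurable_continuous_onI continuous_intros)
  have "ennreal ((cmod (g w))\<^sup>2) * ennreal (pi * r\<^sup>2)
      = ennreal ((cmod (g w))\<^sup>2) * emeasure lborel (ball (0::complex) r)"
    using \<open>0 \<le> r\<close> by (simp add: emeasure_ball unit_ball_vol_2)
  also have "\<dots> = (\<integral>\<^sup>+u. ennreal ((cmod (g w))\<^sup>2) * indicator (ball (0::complex) r) u \<partial>lborel)"
    by (simp add: nn_integral_cmult_indicator)
  also have "\<dots> \<le> (\<integral>\<^sup>+u. \<integral>\<^sup>+t. H (cis (2 * pi * t) * u) * indicator {0..1::real} t \<partial>lborel \<partial>lborel)"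
  proof (rule nn_integral_mono)
    fix u :: complex
    have "ennreal ((cmod (g w))\<^sup>2) \<le> (\<integral>\<^sup>+t. H (cis (2 * pi * t) * u) * indicator {0..1::real} t \<partial>lborel)"
      if u: "u \<in> ball 0 r"
    proof -
      have *: "w + v * u \<in> ball w r" if "cmod v \<le> 1" for v
        using u that by (simp add: dist_norm norm_mult) (meson le_less_trans mult_left_le_one_le norm_ge_zero)
      have "(\<lambda>v. g (w + v * u)) holomorphic_on cball 0 1"
        by (rule holomorphic_on_compose_gen[OF _ g, unfolded o_def]) (use * in \<open>auto intro!: holomorphic_intros\<close>)
      from holomorphic_mean_square_le[OF this] show ?thesis
        using * by (simp add: H_def G_def)
    qed
    then show "ennreal ((cmod (g w))\<^sup>2) * indicator (ball 0 r) u
        \<le> (\<integral>\<^sup>+t. H (cis (2 * pi * t) * u) * indicator {0..1::real} t \<partial>lborel)"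
      by (simp split: split_indicator)
  qed
  also have "\<dots> = (\<integral>\<^sup>+t. \<integral>\<^sup>+u. H (cis (2 * pi * t) * u) * indicator {0..1::real} t \<partial>lborel \<partial>lborel)"
    by (rule lborel_pair.Fubini') measurable
  also have "\<dots> = (\<integral>\<^sup>+t. (\<integral>\<^sup>+u. H u \<partial>lborel) * indicator {0..1::real} t \<partial>lborel)"
    by (simp add: nn_integral_multc nn_integral_rotate)
  also have "\<dots> = (\<integral>\<^sup>+u. H u \<partial>lborel)"
    by (simp add: nn_integral_cmult)
  \<comment> \<open>Rotations fix 0, so the disc was centred there; translation by \<open>w\<close>
    moves it back.\<close>
  also have "\<dots> = (\<integral>\<^sup>+u. G u \<partial>distr lborel borel ((+) w))"
    unfolding H_def by (simp add: nn_integral_distr)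
  also have "\<dots> = (\<integral>\<^sup>+u. G u \<partial>lborel)"
    by (simp add: lborel_distr_plus)
  finally show ?thesis
    by (simp add: G_def)
qed

section \<open>Decay of reverse doubling measures on shrinking boxes\<close>

lemma cis_eq_cis_iff: "cis x = cis y \<longleftrightarrow> (\<exists>n::int. x = y + 2 * pi * n)"
  using sin_cos_eq_iff[of x y] by (auto simp: complex_eq_iff)

text \<open>The interval is shifted by a multiple of \<open>2 * pi\<close> so that it starts in
  \<open>{0..<2 * pi}\<close>. Whatever sticks out beyond \<open>2 * pi\<close> wraps around to an
  initial segment.\<close>

lemma arc_len_cis:
  assumes "a < b" "b - a \<le> 2 * pi"
  shows "arc_len (cis ` {a..b}) = (b - a) / (2 * pi)"
proof -
  define k where "k = \<lfloor>a / (2 * pi)\<rfloor>"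
  define a' where "a' = a - 2 * pi * k"
  define b' where "b' = b - 2 * pi * k"
  have "of_int k \<le> a / (2 * pi)" "a / (2 * pi) < of_int k + 1"
    unfolding k_def by linarith+
  then have a': "0 \<le> a'" "a' < 2 * pi"
    by (simp_all add: a'_def field_simps)
  have b': "a' < b'" "b' - a' \<le> 2 * pi" "b' - a' = b - a"
    using assms by (auto simp: a'_def b'_def)
  define T where "T = {t \<in> {0..<2 * pi}. cis t \<in> cis ` {a..b}}"
  have mem: "cis t \<in> cis ` {a..b} \<longleftrightarrow> t \<in> {a'..b'} \<or> t + 2 * pi \<in> {a'..b'}"
    if t: "t \<in> {0..<2 * pi}" for t
  proof
    assume "cis t \<in> cis ` {a..b}"
    then obtain x n where x: "x \<in> {a..b}" "t = x + 2 * pi * of_int n"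
      by (auto simp: cis_eq_cis_iff)
    define m where "m = - n - k"
    have tm: "t + 2 * pi * of_int m \<in> {a'..b'}"
      using x by (auto simp: a'_def b'_def m_def algebra_simps)
    \<comment> \<open>Since \<open>0 \<le> a'\<close> and \<open>b' < 4 * pi\<close>, a point
      \<open>t\<close> of \<open>{0..<2 * pi}\<close> can reach the shifted interval only after zero
      turns or one turn.\<close>
    have "2 * pi * of_int m < 2 * pi * 2" "2 * pi * (-1) < 2 * pi * of_int m"
      using tm t a' b' unfolding atLeastAtMost_iff atLeastLessThan_iff by linarith+
    then have "of_int m < (2::real)" "(-1::real) < of_int m"
      by (auto simp only: mult_less_cancel_left_pos[of "2 * pi"] mult_pos_pos pi_gt_zero zero_less_numeral)
    then have "m = 0 \<or> m = 1" by linarith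
    then show "t \<in> {a'..b'} \<or> t + 2 * pi \<in> {a'..b'}"
      using tm by auto
  next
    assume "t \<in> {a'..b'} \<or> t + 2 * pi \<in> {a'..b'}"
    then have "\<exists>m::int. t + 2 * pi * of_int m \<in> {a'..b'}"
      by (elim disjE) (intro exI[of _ 0] exI[of _ 1], simp)+
    then obtain m :: int where "t + 2 * pi * of_int m \<in> {a'..b'}" ..
    then have "t + 2 * pi * of_int (m + k) \<in> {a..b}"
      by (simp add: a'_def b'_def algebra_simps)
    moreover have "cis t = cis (t + 2 * pi * of_int (m + k))"
      unfolding cis_eq_cis_iff by (intro exI[of _ "- (m + k)"]) (simp add: algebra_simps)
    ultimately show "cis t \<in> cis ` {a..b}"
      by (rule rev_image_eqI)
  qed
  have T_eq: "T = {t \<in> {0..<2 * pi}. t \<in> {a'..b'} \<or> t + 2 * pi \<in> {a'..b'}}"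
    unfolding T_def using mem by blast
  have "measure lborel T = b' - a'"
  proof (cases "b' < 2 * pi")
    case True
    then have "T = {a'..b'}"
      using a' b' by (auto simp: T_eq)
    then show ?thesis using b' by simp
  next
    case False
    have T: "T = {a'..<2 * pi} \<union> {0..b' - 2 * pi}"
      using a' b' False by (auto simp: T_eq)
    \<comment> \<open>For length exactly \<open>2 * pi\<close> the two pieces share the point
      \<open>a'\<close>, but their union is the full circle; for smaller length they are disjoint
      and their measures add.\<close>
    show ?thesis
    proof (cases "b' - a' = 2 * pi")
      case True
      then have "T = {0..<2 * pi}"
        unfolding T using a' by auto
      then show ?thesis using True by simp
    next
      case less: False
      then have "{a'..<2 * pi} \<inter> {0..b' - 2 * pi} = {}"
        using b' by auto
      then show ?thesis
        unfolding T using False a' by (subst measure_Union) auto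
    qed
  qed
  then show ?thesis
    using b' by (simp add: arc_len_def T_def)
qed

text \<open>With ratio \<open>1/4\<close> instead of \<open>1/2\<close>, the closed box over the next arc lies inside the open half
  box over the current one, so that no null circle has to be discarded.\<close>

definition shrinking_arc :: "real \<Rightarrow> nat \<Rightarrow> complex set" where
  "shrinking_arc \<theta> n = cis ` {\<theta> - pi * (1/4)^n..\<theta> + pi * (1/4)^n}"

lemma arc_len_shrinking_arc: "arc_len (shrinking_arc \<theta> n) = (1/4)^n"
proof -
  have "(1/4::real)^n \<le> 1" by (intro power_le_one) auto
  then have "pi * (1/4::real)^n \<le> pi" by (simp add: mult_left_le)
  moreover have "0 < pi * (1/4::real)^n" by simp
  ultimately show ?thesis
    unfolding shrinking_arc_def by (subst arc_len_cis) (linarith | (simp; fail) | simp add: not_le)+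
qed

lemma circle_arc_shrinking_arc: "circle_arc (shrinking_arc \<theta> n)"
proof -
  have "0 < pi * (1/4::real)^n" by simp
  then have "\<theta> - pi * (1/4)^n < \<theta> + pi * (1/4)^n" by linarith
  then show ?thesis
    unfolding circle_arc_def shrinking_arc_def
    by (intro exI[of _ "{\<theta> - pi * (1/4)^n..\<theta> + pi * (1/4)^n}"]) (simp add: is_interval_cc not_le)
qed

lemma borel_shrinking_arc [measurable]: "shrinking_arc \<theta> n \<in> sets borel"
  unfolding shrinking_arc_def
  by (intro borel_closed compact_imp_closed compact_continuous_image continuous_intros) auto

lemma shrinking_arc_mono: "shrinking_arc \<theta> (Suc n) \<subseteq> shrinking_arc \<theta> n"
proof -
  have "pi * (1/4::real)^Suc n \<le> pi * (1/4)^n" by simp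
  then show ?thesis unfolding shrinking_arc_def by (intro image_mono) auto
qed

lemma carleson_box_subset_boundary_half_box:
  "carleson_box (shrinking_arc \<theta> (Suc n)) \<subseteq> boundary_half_box (shrinking_arc \<theta> n)"
proof -
  have "1 - (1/4::real)^n / 2 < 1 - (1/4)^Suc n" by simp
  then show ?thesis
    using shrinking_arc_mono[of \<theta> n]
    by (auto simp: carleson_box_def boundary_half_box_def arc_len_shrinking_arc simp del: power_Suc)
qed

lemma borel_boxes [measurable]:
  "carleson_box (shrinking_arc \<theta> n) \<in> sets borel"
  "boundary_half_box (shrinking_arc \<theta> n) \<in> sets borel"
  unfolding carleson_box_def boundary_half_box_def by measurable

text \<open>Each passage to the next arc costs one factor \<delta>: the smaller box lies in the half
  box over the current arc, where reverse doubling applies. The induction starts from the total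
  mass.\<close>

lemma reverse_doubling_decay:
  assumes sets: "sets \<sigma> = sets (restrict_space borel unit_disk)" and fin: "finite_measure \<sigma>"
    and \<delta>: "0 \<le> \<delta>" "\<And>I. circle_arc I \<Longrightarrow> 0 < emeasure \<sigma> (carleson_box I) \<and>
      measure \<sigma> (boundary_half_box I) / measure \<sigma> (carleson_box I) < \<delta>"
  shows "carleson_box (shrinking_arc \<theta> n) \<in> sets \<sigma>"
    and "measure \<sigma> (carleson_box (shrinking_arc \<theta> n)) \<le> \<delta> ^ n * measure \<sigma> (space \<sigma>)"
proof -
  interpret finite_measure \<sigma> by fact
  have mem: "A \<in> sets \<sigma>" if "A \<in> sets borel" "A \<subseteq> unit_disk" for A
    unfolding sets using that by (simp add: sets_restrict_space_iff)
  show "carleson_box (shrinking_arc \<theta> n) \<in> sets \<sigma>"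
    by (rule mem) (auto simp: carleson_box_def[of "shrinking_arc _ _"] intro: borel_boxes)
  have B: "boundary_half_box (shrinking_arc \<theta> n) \<in> sets \<sigma>" for n
    by (rule mem) (auto simp: boundary_half_box_def[of "shrinking_arc _ _"] intro: borel_boxes)
  show "measure \<sigma> (carleson_box (shrinking_arc \<theta> n)) \<le> \<delta> ^ n * measure \<sigma> (space \<sigma>)"
  proof (induction n)
    case 0
    show ?case by (simp add: bounded_measure)
  next
    case (Suc n)
    let ?I = "shrinking_arc \<theta> n"
    have "measure \<sigma> (carleson_box (shrinking_arc \<theta> (Suc n))) \<le> measure \<sigma> (boundary_half_box ?I)"
      by (intro finite_measure_mono carleson_box_subset_boundary_half_box B)
    also have "\<dots> \<le> \<delta> * measure \<sigma> (carleson_box ?I)"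
      using \<delta>(2)[OF circle_arc_shrinking_arc[of \<theta> n]]
      by (auto simp: emeasure_eq_measure field_simps)
    also have "\<dots> \<le> \<delta> * (\<delta> ^ n * measure \<sigma> (space \<sigma>))"
      using Suc \<delta> by (intro mult_left_mono)
    finally show ?case by simp
  qed
qed

section \<open>Geometry of the radii that pass near a given point\<close>

lemma ex_quarter_power_bracket:
  fixes x :: real
  assumes "0 < x" "x \<le> 1"
  obtains n where "(1/4) ^ Suc n < x" "x \<le> (1/4) ^ n"
proof -
  define m where "m = (LEAST n. (1/4) ^ n < x)"
  have "\<exists>n. (1/4) ^ n < x"
    using real_arch_pow_inv[of x "1/4"] assms by auto
  then have m: "(1/4) ^ m < x"
    unfolding m_def by (rule LeastI_ex)
  with assms obtain n where n: "m = Suc n"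
    by (cases m) auto
  then have "\<not> (1/4) ^ n < x"
    using not_less_Least[of n "\<lambda>n. (1/4) ^ n < x"] by (simp add: m_def)
  with m n that show ?thesis by auto
qed

text \<open>The angle is the imaginary part of \<open>Ln q\<close>. The linear approximation of the
  logarithm at 1 bounds it by \<open>x + x^2 / (1 - x) = x / (1 - x)\<close>, where \<open>x\<close>
  is the distance from \<open>q\<close> to 1.\<close>

lemma unit_complex_eq_cis_small:
  assumes "cmod q = 1" "cmod (q - 1) \<le> d" "d < 1"
  obtains \<phi> where "q = cis \<phi>" "\<bar>\<phi>\<bar> \<le> d / (1 - d)"
proof -
  have q: "q \<noteq> 0" using assms by auto
  define x where "x = q - 1"
  have x: "cmod x \<le> d" "cmod x < 1" "q = 1 + x" using assms by (auto simp: x_def)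
  have "cmod (Ln q) \<le> cmod (Ln (1 + x) - x) + cmod x"
    using norm_triangle_ineq[of "Ln (1 + x) - x" x] by (simp add: x(3))
  also have "\<dots> \<le> (cmod x)\<^sup>2 / (1 - cmod x) + cmod x"
    using Ln_approx_linear[OF x(2)] by simp
  also have "\<dots> = cmod x / (1 - cmod x)"
    using x(2) by (simp add: field_simps power2_eq_square)
  also have "\<dots> \<le> d / (1 - d)"
    using x assms order_trans[OF norm_ge_zero x(1)] by (intro frac_le) auto
  finally have "\<bar>Im (Ln q)\<bar> \<le> d / (1 - d)"
    using abs_Im_le_cmod[of "Ln q"] by linarith
  moreover have "q = cis (Im (Ln q))"
  proof -
    have "q = exp (Ln q)" using q by simp
    also have "\<dots> = cis (Im (Ln q))"
      using q assms(1) by (subst exp_eq_polar) (simp add: Re_Ln)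
    finally show ?thesis .
  qed
  ultimately show ?thesis using that by blast
qed

text \<open>First the numerator is changed from \<open>u\<close> to \<open>w\<close>, then the
  divisor. Each change costs at most \<open>cmod (w - u) / cmod u\<close>, hence the factor
  2.\<close>

lemma norm_diff_normalized_le:
  fixes u w :: complex
  assumes "u \<noteq> 0" "w \<noteq> 0"
  shows "cmod (w / cmod w - u / cmod u) \<le> 2 * cmod (w - u) / cmod u"
proof -
  have "w / cmod w - u / cmod u = (w - u) / cmod u + w * of_real (1 / cmod w - 1 / cmod u)"
    using assms by (simp add: field_simps)
  also have "cmod \<dots> \<le> cmod (w - u) / cmod u + cmod w * \<bar>1 / cmod w - 1 / cmod u\<bar>"
    by (rule order_trans[OF norm_triangle_ineq]) (simp add: norm_divide norm_mult del: of_real_diff)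
  also have "cmod w * \<bar>1 / cmod w - 1 / cmod u\<bar> = \<bar>cmod u - cmod w\<bar> / cmod u"
  proof -
    have "1 / cmod w - 1 / cmod u = (cmod u - cmod w) / (cmod w * cmod u)"
      using assms by (simp add: field_simps)
    then show ?thesis using assms by (simp add: abs_mult)
  qed
  also have "\<dots> \<le> cmod (w - u) / cmod u"
    using norm_triangle_ineq3[of u w] by (intro divide_right_mono) (auto simp: norm_minus_commute)
  finally show ?thesis by simp
qed

text \<open>The point \<open>w = t * z\<close> is close to \<open>u\<close> compared with its
  distance from the circle, so its depth and its angular offset are both of order \<open>s\<close>.
  As \<open>z\<close> lies farther out on the same radius, it inherits both bounds.\<close>

lemma mem_carleson_box_of_radial_near:
  assumes z: "cmod z < 1" and t: "0 \<le> t" "t \<le> 1"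
    and near: "cmod (u - of_real t * z) < (1 - cmod (of_real t * z)) / 2"
    and u: "u = of_real (1 - s) * cis \<alpha>" and s: "0 < s" "s < 1/8"
    and n: "2 * s \<le> (1/4) ^ n"
  shows "z \<in> carleson_box (shrinking_arc \<alpha> n)"
proof -
  define w where "w = of_real t * z"
  have cu: "cmod u = 1 - s" using s by (simp add: u norm_mult del: of_real_diff)
  have near': "cmod (u - w) < (1 - cmod w) / 2" using near by (simp add: w_def)
  have "\<bar>cmod u - cmod w\<bar> \<le> cmod (u - w)" by (rule norm_triangle_ineq3)
  then have "cmod u - cmod w \<le> cmod (u - w)" by linarith
  then have wl: "1 - 2 * s < cmod w" using near' cu by (simp add: field_simps)
  then have close: "cmod (u - w) < s" using near' by (simp add: field_simps)
  have wz: "cmod w \<le> cmod z" using t by (simp add: w_def norm_mult mult_left_le_one_le)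
  have w0: "w \<noteq> 0" "u \<noteq> 0" using wl s cu by auto
  then have "t \<noteq> 0" by (auto simp: w_def)
  then have zw: "z / cmod z = w / cmod w"
    using t by (simp add: w_def norm_mult)
  define q where "q = (w / cmod w) / cis \<alpha>"
  have q1: "cmod q = 1" using w0 by (simp add: q_def norm_divide norm_mult)
  have q3: "cmod (q - 1) \<le> 3 * s"
  proof -
    have "u / cmod u = cis \<alpha>" using s unfolding cu by (simp add: u)
    then have "q - 1 = (w / cmod w - u / cmod u) / cis \<alpha>"
      by (simp add: q_def diff_divide_distrib)
    then have "cmod (q - 1) \<le> 2 * cmod (w - u) / cmod u"
      using norm_diff_normalized_le[OF w0(2,1)] by (simp add: norm_divide)
    also have "\<dots> \<le> 2 * s / cmod u"
      using close by (intro divide_right_mono) (auto simp: norm_minus_commute)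
    \<comment> \<open>Here \<open>cmod u = 1 - s\<close>, and \<open>s < 1/8\<close> leaves ample
      room for \<open>2 / (1 - s) \<le> 3\<close>.\<close>
    also have "\<dots> \<le> 3 * s" using s by (simp add: cu field_simps)
    finally show ?thesis .
  qed
  obtain \<phi> where \<phi>: "q = cis \<phi>" "\<bar>\<phi>\<bar> \<le> 3 * s / (1 - 3 * s)"
    by (rule unit_complex_eq_cis_small[OF q1 q3]) (use s in auto)
  \<comment> \<open>The denominator exceeds 1/2. The scale condition
    \<open>2 * s \<le> (1/4) ^ n\<close> together with \<open>3 < pi\<close> then fits the angle
    into the arc; the same condition gives the depth of the box at the end.\<close>
  have "3 * s / (1 - 3 * s) \<le> 3 * (2 * s)" using s by (simp add: field_simps)
  also have "\<dots> \<le> pi * (1/4) ^ n" using n s pi_gt3 by (intro mult_mono) auto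
  finally have "\<bar>\<phi>\<bar> \<le> pi * (1/4) ^ n" using \<phi> by linarith
  moreover have "z / cmod z = cis (\<alpha> + \<phi>)"
  proof -
    have "z / cmod z = cis \<alpha> * q" by (simp add: q_def zw)
    then show ?thesis by (simp add: \<phi>(1) cis_mult)
  qed
  ultimately have "z / cmod z \<in> shrinking_arc \<alpha> n"
    unfolding shrinking_arc_def by (intro image_eqI[of _ _ "\<alpha> + \<phi>"]) (simp_all add: abs_le_iff)
  then show ?thesis
    using z wl wz n by (simp add: carleson_box_def arc_len_shrinking_arc)
qed

text \<open>Writing the doubling constant as a power of 1/4 turns the geometric decay over arcs into
  a power of the arc length. The arc used is the shortest of the family, centred at the argument of
  \<open>u\<close>, whose length is still at least \<open>2 * s\<close>; it is shorter than
  \<open>8 * s\<close>, which is the source of the 8.\<close>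

lemma reverse_doubling_radial_near:
  assumes sets: "sets \<sigma> = sets (restrict_space borel unit_disk)" and fin: "finite_measure \<sigma>"
    and \<epsilon>: "0 < \<epsilon>" and rd: "\<And>I. circle_arc I \<Longrightarrow> 0 < emeasure \<sigma> (carleson_box I) \<and>
      measure \<sigma> (boundary_half_box I) / measure \<sigma> (carleson_box I) < (1/4) powr \<epsilon>"
    and u: "cmod u < 1"
  obtains A where "A \<in> sets \<sigma>" "measure \<sigma> A \<le> (8 * (1 - cmod u)) powr \<epsilon> * measure \<sigma> (space \<sigma>)"
    "\<And>z t. cmod z < 1 \<Longrightarrow> 0 \<le> t \<Longrightarrow> t \<le> 1 \<Longrightarrow>
      cmod (u - of_real t * z) < (1 - cmod (of_real t * z)) / 2 \<Longrightarrow> z \<in> A"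
proof (cases "1 - cmod u < 1/8")
  case False
  \<comment> \<open>Away from the circle the bound is at least the total mass, so the whole disk can
    serve as \<open>A\<close>.\<close>
  have "space \<sigma> = unit_disk"
    using sets_eq_imp_space_eq[OF sets] by (simp add: space_restrict_space)
  moreover have "1 \<le> (8 * (1 - cmod u)) powr \<epsilon>"
    using False \<epsilon> by (intro ge_one_powr_ge_zero) auto
  ultimately show ?thesis
    using mult_right_mono[of 1 _ "measure \<sigma> (space \<sigma>)"]
    by (intro that[of "space \<sigma>"] sets.top) auto
next
  case True
  define s where "s = 1 - cmod u"
  have s: "0 < s" "s < 1/8" using u True by (auto simp: s_def)
  have us: "u = of_real (1 - s) * cis (Arg u)"
    using rcis_cmod_Arg[of u] by (simp add: s_def rcis_def)
  obtain n where n: "(1/4) ^ Suc n < 2 * s" "2 * s \<le> (1/4) ^ n"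
    using ex_quarter_power_bracket[of "2 * s"] s by auto
  note decay = reverse_doubling_decay[OF sets fin _ rd, of "Arg u" n]
  have "((1/4) powr \<epsilon>) ^ n = ((1/4) ^ n) powr \<epsilon>"
    by (simp add: powr_realpow[symmetric] powr_powr powr_power mult.commute)
  also have "\<dots> \<le> (8 * s) powr \<epsilon>"
    using n(1) \<epsilon> by (intro powr_mono2) auto
  finally have "((1/4) powr \<epsilon>) ^ n * measure \<sigma> (space \<sigma>) \<le> (8 * s) powr \<epsilon> * measure \<sigma> (space \<sigma>)"
    by (intro mult_right_mono) auto
  then have "measure \<sigma> (carleson_box (shrinking_arc (Arg u) n)) \<le> (8 * (1 - cmod u)) powr \<epsilon> * measure \<sigma> (space \<sigma>)"
    using decay(2) by (simp add: s_def)
  moreover have "carleson_box (shrinking_arc (Arg u) n) \<in> sets \<sigma>"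
    by (rule decay(1)) simp
  ultimately show ?thesis
    using mem_carleson_box_of_radial_near[OF _ _ _ _ us s n(2)]
    by (intro that[of "carleson_box (shrinking_arc (Arg u) n)"]) auto
qed

section \<open>Radial growth of holomorphic functions\<close>

text \<open>In the Cauchy-Schwarz inequality the factor \<open>a\<close> carries the weight and
  \<open>b\<close> the derivative with the inverse weight. The square of \<open>a\<close> has
  exponent \<open>\<epsilon> - 1 > -1\<close>, so its integral stays bounded uniformly in
  \<open>z\<close>, even as \<open>z\<close> approaches the circle.\<close>

lemma norm_radial_increment_le:
  assumes f: "f holomorphic_on unit_disk" and z: "cmod z < 1" and \<epsilon>: "0 < \<epsilon>"
  shows "ennreal ((cmod (f z - f 0))\<^sup>2) \<le> ennreal (1 / \<epsilon>) *
    (\<integral>\<^sup>+t. ennreal (cmod z * (1 - t * cmod z) powr (1 - \<epsilon>) * (cmod (deriv f (of_real t * z)))\<^sup>2)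
      * indicator {0..1} t \<partial>lborel)"
proof -
  define r where "r = cmod z"
  have r: "0 \<le> r" "r < 1" using z by (auto simp: r_def)
  define h where "h = (\<lambda>t. z * deriv f (of_real t * z))"
  have tz: "of_real t * z \<in> unit_disk" if "t \<in> {0..1}" for t
    using that z mult_left_le_one_le[of "cmod z" t] by (simp add: norm_mult)
  have tr: "t * r < 1" if "t \<in> {0..1}" for t
    using tz[OF that] that by (simp add: norm_mult r_def)
  have f': "continuous_on {0..1} (\<lambda>t. deriv f (of_real t * z))"
    by (rule continuous_on_compose2[OF holomorphic_on_imp_continuous_on[OF holomorphic_deriv[OF f]]])
      (use tz in \<open>auto intro!: continuous_intros\<close>)
  then have h: "continuous_on {0..1} h"
    unfolding h_def by (intro continuous_intros)
  have "(h has_integral f (of_real 1 * z) - f (of_real 0 * z)) {0..1}"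
  proof (rule fundamental_theorem_of_calculus)
    fix t :: real
    assume t: "t \<in> {0..1}"
    have "(f has_field_derivative deriv f (of_real t * z)) (at (of_real t * z))"
      using holomorphic_derivI[OF f open_ball tz[OF t]] .
    moreover have "((\<lambda>t. of_real t * z) has_vector_derivative z) (at t)"
      by (auto intro!: derivative_eq_intros)
    ultimately have "(f \<circ> (\<lambda>t. of_real t * z) has_vector_derivative h t) (at t)"
      unfolding h_def by (rule field_vector_diff_chain_at[rotated])
    then show "((\<lambda>t. f (of_real t * z)) has_vector_derivative h t) (at t within {0..1})"
      unfolding o_def by (rule has_vector_derivative_at_within)
  qed simp
  then have hI: "(h has_integral f z - f 0) {0..1}" by simp
  define a where "a = (\<lambda>t. indicator {0..1} t *\<^sub>R sqrt (r * (1 - t * r) powr (\<epsilon> - 1)))"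
  define b where "b = (\<lambda>t. indicator {0..1} t *\<^sub>R
    (sqrt (r * (1 - t * r) powr (1 - \<epsilon>)) * cmod (deriv f (of_real t * z))))"
  have [measurable]: "a \<in> borel_measurable borel" "b \<in> borel_measurable borel"
    unfolding a_def b_def using tr
    by (intro borel_measurable_continuous_on_indicator continuous_intros f' ballI; force)+
  have "cmod (f z - f 0) \<le> integral {0..1} (\<lambda>t. cmod (h t))"
    unfolding integral_unique[OF hI, symmetric]
    by (intro integral_norm_bound_integral integrable_continuous_interval h continuous_intros) auto
  then have "ennreal (cmod (f z - f 0)) \<le> ennreal (integral {0..1} (\<lambda>t. cmod (h t)))"
    by (rule ennreal_leI)
  also have "\<dots> = (\<integral>\<^sup>+t. ennreal (cmod (h t)) * indicator {0..1} t \<partial>lborel)"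
    by (intro nn_integral_has_integral_lebesgue'[symmetric] integrable_integral
        integrable_continuous_interval h continuous_intros) auto
  also have "\<dots> = (\<integral>\<^sup>+t. ennreal (a t) * ennreal (b t) \<partial>lborel)"
  proof (intro nn_integral_cong)
    fix t
    have "a t * b t = cmod (h t)" if t: "t \<in> {0..1}"
    proof -
      have "(1 - t * r) powr (\<epsilon> - 1) * (1 - t * r) powr (1 - \<epsilon>) = 1"
        using tr[OF t] by (simp flip: powr_add)
      then have "sqrt (r * (1 - t * r) powr (\<epsilon> - 1)) * sqrt (r * (1 - t * r) powr (1 - \<epsilon>)) = r"
        using r by (simp add: mult_ac flip: real_sqrt_mult)
      then show ?thesis
        using t by (simp add: a_def b_def h_def norm_mult r_def mult.assoc[symmetric])
    qed
    then show "ennreal (cmod (h t)) * indicator {0..1} t = ennreal (a t) * ennreal (b t)"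
      using r by (cases "t \<in> {0..1}") (auto simp: a_def b_def simp flip: ennreal_mult)
  qed
  finally have "(ennreal (cmod (f z - f 0)))\<^sup>2 \<le> (\<integral>\<^sup>+t. ennreal (a t) * ennreal (b t) \<partial>lborel)\<^sup>2"
    by (intro power_mono) auto
  also have "\<dots> \<le> (\<integral>\<^sup>+t. (ennreal (a t))\<^sup>2 \<partial>lborel) * (\<integral>\<^sup>+t. (ennreal (b t))\<^sup>2 \<partial>lborel)"
    by (rule Cauchy_Schwarz_nn_integral) measurable
  also have "(\<integral>\<^sup>+t. (ennreal (a t))\<^sup>2 \<partial>lborel)
      = (\<integral>\<^sup>+t. ennreal (r * (1 - t * r) powr (\<epsilon> - 1)) * indicator {0..1} t \<partial>lborel)"
    using r by (intro nn_integral_cong) (auto simp: a_def ennreal_power split: split_indicator)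
  \<comment> \<open>The integrand is the derivative of
    \<open>- (1 - t * r) powr \<epsilon> / \<epsilon>\<close>, so the integral is
    \<open>(1 - (1 - r) powr \<epsilon>) / \<epsilon>\<close>.\<close>
  also have "\<dots> = ennreal (- ((1 - 1 * r) powr \<epsilon> / \<epsilon>) - - ((1 - 0 * r) powr \<epsilon> / \<epsilon>))"
  proof (rule nn_integral_FTC_Icc)
    fix t :: real
    assume t: "t \<in> {0..1}"
    show "((\<lambda>t. - ((1 - t * r) powr \<epsilon> / \<epsilon>)) has_real_derivative r * (1 - t * r) powr (\<epsilon> - 1)) (at t)"
      using tr[OF t] \<epsilon> by (auto intro!: derivative_eq_intros simp: powr_diff field_simps)
  qed (use r in auto)
  also have "\<dots> \<le> ennreal (1 / \<epsilon>)"
    using \<epsilon> by (intro ennreal_leI) (simp add: field_simps)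
  also have "(\<integral>\<^sup>+t. (ennreal (b t))\<^sup>2 \<partial>lborel) = (\<integral>\<^sup>+t. ennreal (cmod z * (1 - t * cmod z) powr (1 - \<epsilon>) * (cmod (deriv f (of_real t * z)))\<^sup>2)
      * indicator {0..1} t \<partial>lborel)"
    using r by (intro nn_integral_cong)
      (auto simp: b_def ennreal_power power_mult_distrib r_def split: split_indicator)
  finally show ?thesis
    by (simp add: ennreal_power mult_right_mono)
qed

text \<open>The weight of the radial estimate divided by the area of the disc about
  \<open>t * z\<close> whose radius is half the distance to the circle: this produces
  \<open>4 / pi\<close> and lowers the exponent \<open>1 - \<epsilon>\<close> by 2. The factor
  \<open>cmod z\<close> is the speed along the radius.\<close>

definition radial_kernel :: "real \<Rightarrow> complex \<Rightarrow> real \<Rightarrow> complex \<Rightarrow> ennreal" where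
  "radial_kernel \<epsilon> z t u =
    (if 0 \<le> t \<and> t \<le> 1 \<and> cmod (u - of_real t * z) < (1 - cmod (of_real t * z)) / 2
     then ennreal (4 / pi * cmod z * (1 - cmod (of_real t * z)) powr (- 1 - \<epsilon>)) else 0)"

lemma norm_increment_le_radial_kernel:
  assumes f: "f holomorphic_on unit_disk" and z: "cmod z < 1" and \<epsilon>: "0 < \<epsilon>"
  shows "ennreal ((cmod (f z - f 0))\<^sup>2) \<le> ennreal (1 / \<epsilon>) *
    (\<integral>\<^sup>+t. \<integral>\<^sup>+u. radial_kernel \<epsilon> z t u * (ennreal ((cmod (deriv f u))\<^sup>2) * indicator unit_disk u) \<partial>lborel \<partial>lborel)"
proof -
  have "ennreal (cmod z * (1 - t * cmod z) powr (1 - \<epsilon>) * (cmod (deriv f (of_real t * z)))\<^sup>2)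
      \<le> (\<integral>\<^sup>+u. radial_kernel \<epsilon> z t u * (ennreal ((cmod (deriv f u))\<^sup>2) * indicator unit_disk u) \<partial>lborel)"
    if t: "t \<in> {0..1}" for t
  proof -
    define w where "w = of_real t * z"
    have w: "cmod w = t * cmod z" "cmod w < 1"
      using t z mult_left_le_one_le[of "cmod z" t] by (auto simp: norm_mult w_def)
    define \<rho> where "\<rho> = (1 - cmod w) / 2"
    have \<rho>: "0 < \<rho>" using w by (simp add: \<rho>_def)
    define \<kappa> where "\<kappa> = 4 / pi * cmod z * (1 - cmod w) powr (- 1 - \<epsilon>)"
    have "ball w \<rho> \<subseteq> unit_disk"
    proof
      fix v assume "v \<in> ball w \<rho>"
      then have "cmod v < cmod w + \<rho>"
        using norm_triangle_sub[of v w] by (simp add: dist_norm norm_minus_commute)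
      then show "v \<in> unit_disk" using w by (simp add: \<rho>_def field_simps)
    qed
    then have D: "deriv f holomorphic_on ball w \<rho>"
      using holomorphic_deriv[OF f] holomorphic_on_subset by blast
    \<comment> \<open>The kernel value times the area of the disc recovers the weight, so the area
      mean inequality can be inserted at \<open>w\<close>.\<close>
    have "\<kappa> * (pi * \<rho>\<^sup>2) = cmod z * (1 - cmod w) powr (1 - \<epsilon>)"
    proof -
      have "(1 - cmod w) powr (1 - \<epsilon>) = (1 - cmod w) powr (- 1 - \<epsilon>) * (1 - cmod w) powr 2"
        by (simp flip: powr_add)
      then show ?thesis
        using w by (simp add: \<kappa>_def \<rho>_def power_divide powr_numeral)
    qed
    then have "cmod z * (1 - cmod w) powr (1 - \<epsilon>) * (cmod (deriv f w))\<^sup>2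
        = \<kappa> * ((cmod (deriv f w))\<^sup>2 * (pi * \<rho>\<^sup>2))"
      by (metis mult.assoc mult.commute)
    then have "ennreal (cmod z * (1 - cmod w) powr (1 - \<epsilon>) * (cmod (deriv f w))\<^sup>2)
        = ennreal \<kappa> * (ennreal ((cmod (deriv f w))\<^sup>2) * ennreal (pi * \<rho>\<^sup>2))"
      by (simp add: \<kappa>_def flip: ennreal_mult)
    also have "\<dots> \<le> ennreal \<kappa> * (\<integral>\<^sup>+u. ennreal ((cmod (deriv f u))\<^sup>2) * indicator (ball w \<rho>) u \<partial>lborel)"
      using \<rho> by (intro mult_left_mono holomorphic_area_mean_square_le D) auto
    also have "\<dots> = (\<integral>\<^sup>+u. ennreal \<kappa> * (ennreal ((cmod (deriv f u))\<^sup>2) * indicator (ball w \<rho>) u) \<partial>lborel)"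
      using borel_measurable_norm_square_indicator[OF open_ball holomorphic_on_imp_continuous_on[OF D]]
      by (intro nn_integral_cmult[symmetric]) simp
    also have "\<dots> \<le> (\<integral>\<^sup>+u. radial_kernel \<epsilon> z t u * (ennreal ((cmod (deriv f u))\<^sup>2) * indicator unit_disk u) \<partial>lborel)"
    proof (intro nn_integral_mono)
      fix u
      show "ennreal \<kappa> * (ennreal ((cmod (deriv f u))\<^sup>2) * indicator (ball w \<rho>) u)
          \<le> radial_kernel \<epsilon> z t u * (ennreal ((cmod (deriv f u))\<^sup>2) * indicator unit_disk u)"
      proof (cases "u \<in> ball w \<rho>")
        case True
        then have "cmod (u - of_real t * z) < (1 - cmod (of_real t * z)) / 2"
          by (simp add: w_def \<rho>_def dist_norm norm_minus_commute)
        moreover have "u \<in> unit_disk" using True \<open>ball w \<rho> \<subseteq> unit_disk\<close> by blast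
        ultimately show ?thesis
          using True t by (simp add: radial_kernel_def \<kappa>_def w_def)
      qed simp
    qed
    finally show ?thesis by (simp add: w flip: w_def)
  qed
  then have "(\<integral>\<^sup>+t. ennreal (cmod z * (1 - t * cmod z) powr (1 - \<epsilon>) * (cmod (deriv f (of_real t * z)))\<^sup>2)
      * indicator {0..1} t \<partial>lborel)
    \<le> (\<integral>\<^sup>+t. \<integral>\<^sup>+u. radial_kernel \<epsilon> z t u * (ennreal ((cmod (deriv f u))\<^sup>2) * indicator unit_disk u) \<partial>lborel \<partial>lborel)"
    by (intro nn_integral_mono) (simp split: split_indicator)
  then show ?thesis
    by (intro order_trans[OF norm_radial_increment_le[OF assms]] mult_left_mono) auto
qed

section \<open>The Carleson inequality\<close>

lemma borel_measurable_radial_kernel [measurable]: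
  assumes [measurable]: "g \<in> borel_measurable M" "h \<in> borel_measurable M" "k \<in> borel_measurable M"
  shows "(\<lambda>x. radial_kernel \<epsilon> (g x) (h x) (k x)) \<in> borel_measurable M"
  unfolding radial_kernel_def by measurable

text \<open>For fixed \<open>u\<close> only values of \<open>t\<close> with
  \<open>t * cmod z\<close> within \<open>s = 1 - cmod u\<close> of \<open>cmod u\<close>
  contribute: an interval of length \<open>2 * s / cmod z\<close>. There the kernel is at most of
  order \<open>cmod z * s powr (- 1 - \<epsilon>)\<close>, so \<open>cmod z\<close> cancels and the
  order is \<open>s powr (- \<epsilon>)\<close>.\<close>

lemma nn_integral_radial_kernel_le:
  assumes u: "cmod u < 1" and \<epsilon>: "0 < \<epsilon>" and z: "cmod z < 1"
  shows "(\<integral>\<^sup>+t. radial_kernel \<epsilon> z t u \<partial>lborel)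
    \<le> ennreal (8 / pi * (2/3) powr (- 1 - \<epsilon>) * (1 - cmod u) powr (- \<epsilon>))"
proof (cases "z = 0")
  case True
  then have "radial_kernel \<epsilon> z t u = 0" for t by (simp add: radial_kernel_def)
  then show ?thesis by simp
next
  case False
  define r where "r = cmod z"
  define s where "s = 1 - cmod u"
  define c where "c = 4 / pi * r * (2/3 * s) powr (- 1 - \<epsilon>)"
  have r: "0 < r" and s: "0 < s" using False u by (auto simp: r_def s_def)
  have c: "0 \<le> c" using r by (simp add: c_def)
  let ?I = "{(cmod u - s) / r..(cmod u + s) / r}"
  have "radial_kernel \<epsilon> z t u \<le> ennreal c * indicator ?I t" for t
  proof (cases "0 \<le> t \<and> t \<le> 1 \<and> cmod (u - of_real t * z) < (1 - cmod (of_real t * z)) / 2")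
    case True
    define w where "w = of_real t * z"
    have w: "cmod w = t * r" using True by (simp add: w_def r_def norm_mult)
    have near: "cmod (u - w) < (1 - cmod w) / 2" using True by (simp add: w_def)
    have "\<bar>cmod u - cmod w\<bar> \<le> cmod (u - w)" by (rule norm_triangle_ineq3)
    then have *: "\<bar>cmod u - cmod w\<bar> < (1 - cmod w) / 2" using near by linarith
    \<comment> \<open>With \<open>d = 1 - cmod w\<close> the previous inequality reads
      \<open>\<bar>d - s\<bar> < d / 2\<close>, hence \<open>2/3 * s < d < 2 * s\<close>. The lower
      bound controls the negative power, the upper one the range of \<open>t\<close>.\<close>
    then have lo: "2/3 * s < 1 - cmod w" and hi: "\<bar>cmod u - cmod w\<bar> < s"
      unfolding s_def abs_less_iff by (simp_all add: field_simps)
    have "(1 - cmod w) powr (- 1 - \<epsilon>) \<le> (2/3 * s) powr (- 1 - \<epsilon>)"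
      using lo s \<epsilon> by (intro powr_mono2') auto
    then have "4 / pi * r * (1 - cmod w) powr (- 1 - \<epsilon>) \<le> c"
      unfolding c_def using r by (intro mult_left_mono) auto
    moreover have "t \<in> ?I"
      using hi r unfolding w by (auto simp: field_simps)
    ultimately show ?thesis
      using True by (simp add: radial_kernel_def w_def r_def ennreal_leI)
  qed (auto simp: radial_kernel_def)
  then have "(\<integral>\<^sup>+t. radial_kernel \<epsilon> z t u \<partial>lborel) \<le> (\<integral>\<^sup>+t. ennreal c * indicator ?I t \<partial>lborel)"
    by (rule nn_integral_mono)
  also have "\<dots> = ennreal c * ennreal (2 * s / r)"
    using r s by (subst nn_integral_cmult_indicator) (auto simp: field_simps)
  also have "\<dots> = ennreal (c * (2 * s / r))"
    using c r s by (intro ennreal_mult[symmetric]) auto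
  also have "c * (2 * s / r) = 8 / pi * (2/3) powr (- 1 - \<epsilon>) * (s powr (- 1 - \<epsilon>) * s powr 1)"
    using r s unfolding c_def by (subst powr_mult) (auto simp: field_simps)
  also have "s powr (- 1 - \<epsilon>) * s powr 1 = s powr (- \<epsilon>)"
    by (subst powr_add[symmetric]) simp
  finally show ?thesis by (simp add: s_def)
qed

text \<open>Membership in the space matters: the integral in the norm takes the default value 0 when
  the integrand is not integrable.\<close>

lemma dirichlet_nn_integral_eq:
  assumes "f \<in> dirichlet_space"
  shows "(\<integral>\<^sup>+u. ennreal ((cmod (deriv f u))\<^sup>2) * indicator unit_disk u \<partial>lborel)
    = ennreal (LINT u:unit_disk|lborel. (cmod (deriv f u))\<^sup>2)"
proof -
  have "(\<integral>\<^sup>+u. ennreal ((cmod (deriv f u))\<^sup>2) * indicator unit_disk u \<partial>lborel)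
      = (\<integral>\<^sup>+u. ennreal (indicator unit_disk u *\<^sub>R (cmod (deriv f u))\<^sup>2) \<partial>lborel)"
    by (intro nn_integral_cong) (auto split: split_indicator)
  also have "\<dots> = ennreal (LINT u:unit_disk|lborel. (cmod (deriv f u))\<^sup>2)"
    using assms unfolding dirichlet_space_def set_integrable_def set_lebesgue_integral_def
    by (intro nn_integral_eq_integral) auto
  finally show ?thesis .
qed

text \<open>The measure enters only through its total mass and \<open>decay\<close>, which bounds
  the set of those \<open>z\<close> whose radius passes near \<open>u\<close>. Tonelli then reduces
  the inequality to a bound on the kernel integrated in \<open>t\<close> and \<open>z\<close>,
  uniform in \<open>u\<close>.\<close>

lemma power_decay_imp_carleson_bound:
  fixes \<mu> :: "complex measure"
  assumes sets [measurable_cong]: "sets \<mu> = sets borel" and fin: "finite_measure \<mu>"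
    and \<epsilon>: "0 < \<epsilon>" and M: "0 \<le> M"
    and decay: "\<And>u. cmod u < 1 \<Longrightarrow> \<exists>A\<in>sets \<mu>. emeasure \<mu> A \<le> ennreal (M * (1 - cmod u) powr \<epsilon>) \<and>
      (\<forall>z t. cmod z < 1 \<and> 0 \<le> t \<and> t \<le> 1 \<and>
        cmod (u - of_real t * z) < (1 - cmod (of_real t * z)) / 2 \<longrightarrow> z \<in> A)"
  shows "\<exists>C\<ge>0. \<forall>f\<in>dirichlet_space.
    (\<integral>\<^sup>+z\<in>unit_disk. ennreal ((cmod (f z))\<^sup>2) \<partial>\<mu>) \<le> ennreal (C * (dirichlet_norm f)\<^sup>2)"
proof -
  interpret finite_measure \<mu> by fact
  interpret pair_sigma_finite \<mu> lborel ..
  define K where "K = 8 / pi * (2/3) powr (- 1 - \<epsilon>) * M"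
  have K: "0 \<le> K" using M by (simp add: K_def)
  \<comment> \<open>The integral over \<open>t\<close> contributes
    \<open>s powr (- \<epsilon>)\<close> and vanishes for \<open>z\<close> in the disk outside
    \<open>A\<close>, while the measure of \<open>A\<close> contributes
    \<open>s powr \<epsilon>\<close>; the powers cancel.\<close>
  have kernel: "(\<integral>\<^sup>+z. (\<integral>\<^sup>+t. radial_kernel \<epsilon> z t u \<partial>lborel) * indicator unit_disk z \<partial>\<mu>) \<le> ennreal K"
    if u: "cmod u < 1" for u
  proof -
    define s where "s = 1 - cmod u"
    define c where "c = 8 / pi * (2/3) powr (- 1 - \<epsilon>) * s powr (- \<epsilon>)"
    have s: "0 < s" using u by (simp add: s_def)
    obtain A where A: "A \<in> sets \<mu>" "emeasure \<mu> A \<le> ennreal (M * s powr \<epsilon>)"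
      and mem: "\<And>z t. cmod z < 1 \<Longrightarrow> 0 \<le> t \<Longrightarrow> t \<le> 1 \<Longrightarrow>
        cmod (u - of_real t * z) < (1 - cmod (of_real t * z)) / 2 \<Longrightarrow> z \<in> A"
      using decay[OF u] unfolding s_def by blast
    have "(\<integral>\<^sup>+z. (\<integral>\<^sup>+t. radial_kernel \<epsilon> z t u \<partial>lborel) * indicator unit_disk z \<partial>\<mu>)
        \<le> (\<integral>\<^sup>+z. ennreal c * indicator A z \<partial>\<mu>)"
    proof (intro nn_integral_mono)
      fix z
      show "(\<integral>\<^sup>+t. radial_kernel \<epsilon> z t u \<partial>lborel) * indicator unit_disk z \<le> ennreal c * indicator A z"
      proof (cases "cmod z < 1")
        case z: True
        show ?thesis
        proof (cases "z \<in> A")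
          case True
          then show ?thesis
            using nn_integral_radial_kernel_le[OF u \<epsilon> z] z by (simp add: c_def s_def)
        next
          case False
          then have "radial_kernel \<epsilon> z t u = 0" for t
            using mem[OF z] by (auto simp: radial_kernel_def)
          then show ?thesis by simp
        qed
      qed simp
    qed
    also have "\<dots> = ennreal c * emeasure \<mu> A"
      using A by (intro nn_integral_cmult_indicator)
    also have "\<dots> \<le> ennreal c * ennreal (M * s powr \<epsilon>)"
      using A by (intro mult_left_mono) auto
    also have "\<dots> = ennreal (c * (M * s powr \<epsilon>))"
      using M by (intro ennreal_mult[symmetric]) (auto simp: c_def)
    also have "c * (M * s powr \<epsilon>) = K * (s powr (- \<epsilon>) * s powr \<epsilon>)"
      by (simp add: c_def K_def)
    also have "s powr (- \<epsilon>) * s powr \<epsilon> = 1"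
      using s by (simp flip: powr_add)
    finally show ?thesis by simp
  qed
  define m where "m = measure \<mu> (space \<mu>)"
  \<comment> \<open>The factors 2 come from splitting the square of
    \<open>f 0 + (f z - f 0)\<close>. The first term pays for \<open>f 0\<close>, the second for the
    increment, with \<open>pi\<close> undoing the normalization in the Dirichlet norm.\<close>
  define C where "C = 2 * m + 2 * K * pi / \<epsilon>"
  have m: "0 \<le> m" by (simp add: m_def)
  have "(\<integral>\<^sup>+z\<in>unit_disk. ennreal ((cmod (f z))\<^sup>2) \<partial>\<mu>) \<le> ennreal (C * (dirichlet_norm f)\<^sup>2)"
    if f: "f \<in> dirichlet_space" for f
  proof -
    have hol: "f holomorphic_on unit_disk" using f by (simp add: dirichlet_space_def)
    define E where "E = (LINT u:unit_disk|lborel. (cmod (deriv f u))\<^sup>2)"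
    define G where "G = (\<lambda>u. ennreal ((cmod (deriv f u))\<^sup>2) * indicator unit_disk u)"
    have E: "0 \<le> E" "(\<integral>\<^sup>+u. G u \<partial>lborel) = ennreal E"
      unfolding E_def G_def using dirichlet_nn_integral_eq[OF f]
      by (auto simp: set_lebesgue_integral_def intro!: integral_nonneg_AE)
    have G [measurable]: "G \<in> borel_measurable borel"
      unfolding G_def
      by (intro borel_measurable_norm_square_indicator holomorphic_on_imp_continuous_on
          holomorphic_deriv hol open_ball)
    have D [measurable]: "unit_disk \<in> sets borel" by simp
    define P where "P = (\<lambda>z u. (\<integral>\<^sup>+t. radial_kernel \<epsilon> z t u \<partial>lborel) * indicator unit_disk z)"
    have P [measurable]: "(\<lambda>x. P (fst x) (snd x)) \<in> borel_measurable (\<mu> \<Otimes>\<^sub>M lborel)"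
      unfolding P_def by measurable
    have "(\<integral>\<^sup>+z. ennreal ((cmod (f z))\<^sup>2) * indicator unit_disk z \<partial>\<mu>)
        \<le> (\<integral>\<^sup>+z. ennreal (2 * (cmod (f 0))\<^sup>2) + ennreal (2 / \<epsilon>) * (\<integral>\<^sup>+u. P z u * G u \<partial>lborel) \<partial>\<mu>)"
    proof (intro nn_integral_mono)
      fix z
      show "ennreal ((cmod (f z))\<^sup>2) * indicator unit_disk z
          \<le> ennreal (2 * (cmod (f 0))\<^sup>2) + ennreal (2 / \<epsilon>) * (\<integral>\<^sup>+u. P z u * G u \<partial>lborel)"
      proof (cases "cmod z < 1")
        case z: True
        have "cmod (f z) \<le> cmod (f 0) + cmod (f z - f 0)"
          using norm_triangle_ineq[of "f 0" "f z - f 0"] by simp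
        then have "(cmod (f z))\<^sup>2 \<le> (cmod (f 0) + cmod (f z - f 0))\<^sup>2"
          by (intro power_mono) auto
        also have "\<dots> \<le> 2 * (cmod (f 0))\<^sup>2 + 2 * (cmod (f z - f 0))\<^sup>2"
          using sum_squares_bound[of "cmod (f 0)" "cmod (f z - f 0)"] by (simp add: power2_sum)
        finally have "ennreal ((cmod (f z))\<^sup>2) \<le> ennreal (2 * (cmod (f 0))\<^sup>2 + 2 * (cmod (f z - f 0))\<^sup>2)"
          by (rule ennreal_leI)
        also have "\<dots> = ennreal (2 * (cmod (f 0))\<^sup>2) + ennreal 2 * ennreal ((cmod (f z - f 0))\<^sup>2)"
          by (subst ennreal_plus) (auto simp: ennreal_mult)
        also have "ennreal ((cmod (f z - f 0))\<^sup>2) \<le> ennreal (1 / \<epsilon>) *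
            (\<integral>\<^sup>+t. \<integral>\<^sup>+u. radial_kernel \<epsilon> z t u * G u \<partial>lborel \<partial>lborel)"
          unfolding G_def by (rule norm_increment_le_radial_kernel[OF hol z \<epsilon>])
        also have "(\<integral>\<^sup>+t. \<integral>\<^sup>+u. radial_kernel \<epsilon> z t u * G u \<partial>lborel \<partial>lborel)
            = (\<integral>\<^sup>+u. \<integral>\<^sup>+t. radial_kernel \<epsilon> z t u * G u \<partial>lborel \<partial>lborel)"
          by (rule lborel_pair.Fubini') measurable
        also have "\<dots> = (\<integral>\<^sup>+u. P z u * G u \<partial>lborel)"
          using z by (simp add: P_def nn_integral_multc)
        finally have "ennreal ((cmod (f z))\<^sup>2) \<le> ennreal (2 * (cmod (f 0))\<^sup>2)
            + ennreal 2 * (ennreal (1 / \<epsilon>) * (\<integral>\<^sup>+u. P z u * G u \<partial>lborel))"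
          by (simp add: mult_left_mono)
        moreover have "2 * ennreal (1 / \<epsilon>) = ennreal (2 / \<epsilon>)"
          using \<epsilon> ennreal_mult[of 2 "1 / \<epsilon>"] by simp
        ultimately show ?thesis
          using z by (simp add: mult.assoc[symmetric])
      qed simp
    qed
    also have "\<dots> = ennreal (2 * (cmod (f 0))\<^sup>2) * emeasure \<mu> (space \<mu>)
        + ennreal (2 / \<epsilon>) * (\<integral>\<^sup>+z. \<integral>\<^sup>+u. P z u * G u \<partial>lborel \<partial>\<mu>)"
      by (simp add: nn_integral_add nn_integral_cmult)
    \<comment> \<open>Tonelli again, now between the given measure and area: the kernel can be
      integrated in \<open>z\<close> first, and \<open>G\<close> restricts attention to
      \<open>u\<close> in the disk, where \<open>kernel\<close> applies.\<close>
    also have "(\<integral>\<^sup>+z. \<integral>\<^sup>+u. P z u * G u \<partial>lborel \<partial>\<mu>) = (\<integral>\<^sup>+u. \<integral>\<^sup>+z. P z u * G u \<partial>\<mu> \<partial>lborel)"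
      by (rule Fubini'[symmetric]) measurable
    also have "\<dots> = (\<integral>\<^sup>+u. (\<integral>\<^sup>+z. P z u \<partial>\<mu>) * G u \<partial>lborel)"
      by (intro nn_integral_cong nn_integral_multc) (simp add: P_def)
    also have "\<dots> \<le> (\<integral>\<^sup>+u. ennreal K * G u \<partial>lborel)"
    proof (intro nn_integral_mono)
      fix u
      show "(\<integral>\<^sup>+z. P z u \<partial>\<mu>) * G u \<le> ennreal K * G u"
        using kernel[of u] unfolding P_def G_def
        by (cases "cmod u < 1") (auto intro!: mult_right_mono)
    qed
    also have "\<dots> = ennreal K * ennreal E"
      by (simp add: nn_integral_cmult E)
    also have "ennreal (2 * (cmod (f 0))\<^sup>2) * emeasure \<mu> (space \<mu>) + ennreal (2 / \<epsilon>) * (ennreal K * ennreal E)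
        = ennreal (2 * (cmod (f 0))\<^sup>2 * m + 2 / \<epsilon> * (K * E))"
    proof -
      have "ennreal (2 / \<epsilon>) * (ennreal K * ennreal E) = ennreal (2 / \<epsilon> * (K * E))"
        using \<epsilon> K E(1) ennreal_mult[of "2 / \<epsilon>" "K * E"] ennreal_mult[of K E] by simp
      moreover have "ennreal (2 * (cmod (f 0))\<^sup>2) * emeasure \<mu> (space \<mu>) = ennreal (2 * (cmod (f 0))\<^sup>2 * m)"
        unfolding emeasure_eq_measure m_def by (subst ennreal_mult) auto
      ultimately show ?thesis
        using m \<epsilon> K E(1) by (subst ennreal_plus) auto
    qed
    also have "\<dots> \<le> ennreal (C * (dirichlet_norm f)\<^sup>2)"
    proof (rule ennreal_leI)
      have "(dirichlet_norm f)\<^sup>2 = (cmod (f 0))\<^sup>2 + E / pi"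
        using E by (simp add: dirichlet_norm_def E_def)
      \<comment> \<open>Multiplying out gives the two wanted terms and two nonnegative cross terms,
        which are dropped.\<close>
      then have "C * (dirichlet_norm f)\<^sup>2 = 2 * (cmod (f 0))\<^sup>2 * m + 2 / \<epsilon> * (K * E)
          + (2 * m * E / pi + 2 * K * pi / \<epsilon> * (cmod (f 0))\<^sup>2)"
        using \<epsilon> by (simp only: C_def) (simp add: field_simps)
      moreover have "0 \<le> 2 * m * E / pi + 2 * K * pi / \<epsilon> * (cmod (f 0))\<^sup>2"
        using m E K \<epsilon> by simp
      ultimately show "2 * (cmod (f 0))\<^sup>2 * m + 2 / \<epsilon> * (K * E) \<le> C * (dirichlet_norm f)\<^sup>2"
        by linarith
    qed
    finally show ?thesis
      by (simp add: add_left_mono mult_left_mono)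
  qed
  moreover have "0 \<le> C" using m K \<epsilon> by (simp add: C_def)
  ultimately show ?thesis by blast
qed

theorem theorem1:
  fixes \<sigma> :: "complex measure"
  assumes "sets \<sigma> = sets (restrict_space borel unit_disk)"
    and "finite_measure \<sigma>"
    and "absolutely_continuous (restrict_space lborel unit_disk) \<sigma>"
    and "reverse_doubling \<sigma>"
  shows "dirichlet_carleson \<sigma>"
proof -
  interpret finite_measure \<sigma> by fact
  note sets = assms(1)
  obtain \<delta> where \<delta>: "\<delta> < 1" and rd: "\<And>I. circle_arc I \<Longrightarrow> 0 < emeasure \<sigma> (carleson_box I) \<and>
      measure \<sigma> (boundary_half_box I) / measure \<sigma> (carleson_box I) < \<delta>"
    using assms(4) unfolding reverse_doubling_def by blast
  \<comment> \<open>Any one arc shows that \<delta> exceeds a nonnegative ratio, so its logarithm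
    can be taken; \<open>\<delta> < 1\<close> makes the exponent positive.\<close>
  have "0 \<le> measure \<sigma> (boundary_half_box (shrinking_arc 0 0)) / measure \<sigma> (carleson_box (shrinking_arc 0 0))"
    by simp
  also have "\<dots> < \<delta>" using rd[OF circle_arc_shrinking_arc] by blast
  finally have \<delta>0: "0 < \<delta>" .
  define \<epsilon> where "\<epsilon> = log (1/4) \<delta>"
  have \<epsilon>: "0 < \<epsilon>" "(1/4) powr \<epsilon> = \<delta>"
    using \<delta> \<delta>0 by (simp_all add: \<epsilon>_def log_def divide_neg_pos ln_div powr_def)
  define M where "M = 8 powr \<epsilon> * measure \<sigma> (space \<sigma>)"
  have id [measurable]: "(\<lambda>z. z) \<in> measurable \<sigma> borel"
    using measurable_restrict_space1[OF measurable_ident, of borel unit_disk]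
    by (simp add: measurable_cong_sets[OF sets refl] id_def)
  \<comment> \<open>The given measure lives on the Borel sets of the disk; its image under inclusion
    is a Borel measure on the whole plane, as the kernel estimate expects. Integrals over the disk
    do not change.\<close>
  define \<mu> where "\<mu> = distr \<sigma> borel (\<lambda>z. z)"
  have \<mu>: "emeasure \<mu> A = emeasure \<sigma> (A \<inter> space \<sigma>)" if "A \<in> sets borel" for A
    using that by (simp add: \<mu>_def emeasure_distr)
  have "\<exists>A\<in>sets \<mu>. emeasure \<mu> A \<le> ennreal (M * (1 - cmod u) powr \<epsilon>) \<and>
      (\<forall>z t. cmod z < 1 \<and> 0 \<le> t \<and> t \<le> 1 \<and>
        cmod (u - of_real t * z) < (1 - cmod (of_real t * z)) / 2 \<longrightarrow> z \<in> A)"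
    if u: "cmod u < 1" for u
  proof -
    obtain A where A: "A \<in> sets \<sigma>" "measure \<sigma> A \<le> (8 * (1 - cmod u)) powr \<epsilon> * measure \<sigma> (space \<sigma>)"
      and mem: "\<And>z t. cmod z < 1 \<Longrightarrow> 0 \<le> t \<Longrightarrow> t \<le> 1 \<Longrightarrow>
        cmod (u - of_real t * z) < (1 - cmod (of_real t * z)) / 2 \<Longrightarrow> z \<in> A"
      using reverse_doubling_radial_near[OF sets assms(2) \<epsilon>(1) rd[folded \<epsilon>(2)] u] by metis
    have "A \<in> sets borel"
      using A(1) unfolding sets by (simp add: sets_restrict_space_iff)
    moreover have "A \<inter> space \<sigma> = A"
      using sets.sets_into_space[OF A(1)] by blast
    ultimately have "A \<in> sets \<mu>" "emeasure \<mu> A = ennreal (measure \<sigma> A)"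
      using \<mu> by (simp_all add: \<mu>_def emeasure_eq_measure)
    moreover have "measure \<sigma> A \<le> M * (1 - cmod u) powr \<epsilon>"
      using A(2) u powr_mult[of 8 "1 - cmod u" \<epsilon>] by (simp add: M_def mult_ac del: right_diff_distrib_numeral)
    ultimately show ?thesis
      using mem by (intro bexI[of _ A]) (auto intro: ennreal_leI)
  qed
  moreover have "finite_measure \<mu>"
    unfolding \<mu>_def by (rule finite_measure_distr) simp
  ultimately obtain C where C: "0 \<le> C" "\<And>f. f \<in> dirichlet_space \<Longrightarrow>
      (\<integral>\<^sup>+z\<in>unit_disk. ennreal ((cmod (f z))\<^sup>2) \<partial>\<mu>) \<le> ennreal (C * (dirichlet_norm f)\<^sup>2)"
    using power_decay_imp_carleson_bound[of \<mu> \<epsilon> M] \<epsilon>(1) by (force simp: \<mu>_def M_def)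
  have "(\<integral>\<^sup>+z\<in>unit_disk. ennreal ((cmod (f z))\<^sup>2) \<partial>\<mu>) = (\<integral>\<^sup>+z\<in>unit_disk. ennreal ((cmod (f z))\<^sup>2) \<partial>\<sigma>)"
    if "f \<in> dirichlet_space" for f
  proof -
    have "f holomorphic_on unit_disk" using that by (simp add: dirichlet_space_def)
    then have "(\<lambda>z. ennreal ((cmod (f z))\<^sup>2) * indicator unit_disk z) \<in> borel_measurable borel"
      by (intro borel_measurable_norm_square_indicator holomorphic_on_imp_continuous_on open_ball)
    then show ?thesis
      unfolding \<mu>_def by (simp add: nn_integral_distr[OF id])
  qed
  with C show ?thesis
    unfolding dirichlet_carleson_def by auto
qed

end
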